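(* Let $f\in C_c^\infty(\mathbb{R}^2)$ be real-valued. For each $p>1$ there exists a function $u:\mathbb{R}^2\to\mathbb{R}^2$ with $u\in \dot{W}^{1,2p}(\mathbb{R}^2)\cap L^\infty(\mathbb{R}^2)$ such that $$\det(\nabla u(x,y))= f(x,y)\quad\text{for all }(x,y)\in\mathbb{R}^2,$$ and furthermore $u\in C^\infty(\mathbb{R}^2)$.
   Context: For a map $u=(u_1,u_2):\mathbb{R}^2\to\mathbb{R}^2$, $\nabla u$ is the $2\times 2$ Jacobian matrix of partial derivatives, so $\det(\nabla u)=\partial_x u_1\,\partial_y u_2-\partial_y u_1\,\partial_x u_2$. The homogeneous Sobolev space $\dot{W}^{1,2p}(\mathbb{R}^2)$ consists here of the locally integrable, weakly differentiable maps $u:\mathbb{R}^2\to\mathbb{R}^2$ with $\nabla u\in L^{2p}(\mathbb{R}^2)$. $C_c^\infty(\mathbb{R}^2)$ denotes the smooth compactly supported functions. *)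

theory Defs
  imports "HOL-Analysis.Analysis"
begin

text \<open>
  For \<^term>\<open>f :: 'a::euclidean_space \<Rightarrow> 'b::real_normed_vector\<close>, being \<open>C\<^sup>k\<close> on the whole space is
  expressed through iterated directional derivatives: at each stage the function is Frechet
  differentiable everywhere, and after \<open>k\<close> stages what remains is continuous.
\<close>

primrec Ck :: "nat \<Rightarrow> ('a::euclidean_space \<Rightarrow> 'b::real_normed_vector) \<Rightarrow> bool" where
  "Ck 0 f \<longleftrightarrow> continuous_on UNIV f"
| "Ck (Suc k) f \<longleftrightarrow>
     (\<forall>x. f differentiable (at x)) \<and> (\<forall>v. Ck k (\<lambda>x. frechet_derivative f (at x) v))"

definition smooth :: "('a::euclidean_space \<Rightarrow> 'b::real_normed_vector) \<Rightarrow> bool" where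
  "smooth f \<longleftrightarrow> (\<forall>k. Ck k f)"

definition Cc_infinity :: "('a::euclidean_space \<Rightarrow> real) set" where
  "Cc_infinity = {f. smooth f \<and> compact (closure {x. f x \<noteq> 0})}"

definition locally_integrable :: "('a::euclidean_space \<Rightarrow> 'b::euclidean_space) \<Rightarrow> bool" where
  "locally_integrable f \<longleftrightarrow> (\<forall>K. compact K \<longrightarrow> set_integrable lebesgue K f)"

text \<open>
  The Lebesgue spaces are sets of functions, not of classes modulo null sets. Values in
  \<^typ>\<open>real ^ 'n ^ 'm\<close> carry the Frobenius norm.
\<close>

definition Lp_space :: "real \<Rightarrow> ('a::euclidean_space \<Rightarrow> 'b::euclidean_space) set" where
  "Lp_space q =
     {f. f \<in> borel_measurable lebesgue \<and> integrable lebesgue (\<lambda>x. norm (f x) powr q)}"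

definition L_infinity :: "('a::euclidean_space \<Rightarrow> 'b::euclidean_space) set" where
  "L_infinity =
     {f. f \<in> borel_measurable lebesgue \<and> (\<exists>C. AE x in lebesgue. norm (f x) \<le> C)}"

text \<open>
  Entry \<open>(i, j)\<close> of a weak gradient is the weak partial derivative \<open>\<partial>\<^sub>j u\<^sub>i\<close>, the same layout as
  \<^const>\<open>jacobian\<close>.
\<close>

definition has_weak_gradient :: "(real ^ 'n \<Rightarrow> real ^ 'm) \<Rightarrow> (real ^ 'n \<Rightarrow> real ^ 'n ^ 'm) \<Rightarrow> bool"
  where
  "has_weak_gradient u G \<longleftrightarrow>
     locally_integrable u \<and> locally_integrable G \<and>
     (\<forall>\<phi>\<in>Cc_infinity. \<forall>i j.
        (LINT x|lebesgue. u x $ i * frechet_derivative \<phi> (at x) (axis j 1)) =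
        - (LINT x|lebesgue. G x $ i $ j * \<phi> x))"

definition homogeneous_Sobolev :: "real \<Rightarrow> (real ^ 'n \<Rightarrow> real ^ 'm) set" where
  "homogeneous_Sobolev q =
     {u. \<exists>G. has_weak_gradient u G \<and> G \<in> Lp_space q}"

end

theory Submission
  imports Defs
begin

text \<open>
  Put \<open>w(y) = sqrt (1 + y\<^sup>2)\<close> and \<open>s = x / w(y)\<close>; the level sets of \<open>s\<close> are curves fanning out in both
  vertical directions. Take \<open>u = (s / sqrt (1 + s\<^sup>2), V(s, y))\<close>, where
  \<open>V(s, y) = (1 + s\<^sup>2)\<^bsup>3/2\<^esup> \<integral>\<^bsub>-R\<^esub>\<^bsup>y\<^esup> w(t) f(s w(t), t) dt\<close> and \<open>f\<close> is supported in the ball of radius \<open>R\<close>.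
  The Jacobian determinant is \<open>(1 + s\<^sup>2)\<^bsup>-3/2\<^esup> (\<partial>s/\<partial>x) (\<partial>V/\<partial>y) = f\<close>. Since \<open>V\<close> vanishes for
  \<open>\<bar>s\<bar> > R\<close> and does not depend on \<open>y\<close> for \<open>\<bar>y\<bar> \<ge> R\<close> (separately above and below), the gradient of \<open>u\<close> is
  \<open>O((1 + \<bar>z\<bar>\<^sup>2)\<^bsup>-1/2\<^esup>)\<close>, which lies in \<open>L\<^bsup>2p\<^esup>\<close> of the plane exactly when \<open>p > 1\<close>.
\<close>

subsection \<open>Calculus of \<open>C\<^sup>k\<close> functions\<close>

text \<open>Derivatives are unique, so any explicit derivative may stand in for the chosen
  \<open>frechet_derivative\<close>. The inductions on \<open>k\<close> below then only need a
  derivative rule and closure of the resulting formula.\<close>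

lemma Ck_SucI:
  assumes "\<And>x. (f has_derivative f' x) (at x)" and "\<And>v. Ck k (\<lambda>x. f' x v)"
  shows "Ck (Suc k) f"
proof -
  have "frechet_derivative f (at x) = f' x" for x
    using assms(1) frechet_derivative_at by metis
  then show ?thesis
    using assms by (auto simp: differentiable_def)
qed

lemma Ck_Suc_has_derivative:
  assumes "Ck (Suc k) f"
  shows "(f has_derivative frechet_derivative f (at x)) (at x)"
  using assms frechet_derivative_works by auto

lemma Ck_Suc_imp_Ck: "Ck (Suc k) f \<Longrightarrow> Ck k f"
proof (induction k arbitrary: f)
  case 0
  then show ?case
    by (auto intro!: differentiable_imp_continuous_on simp: differentiable_on_def)
next
  case (Suc k)
  then show ?case by (metis Ck.simps(2))
qed

lemma Ck_imp_continuous_on: "Ck k f \<Longrightarrow> continuous_on S f"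
proof (induction k)
  case 0
  then show ?case using continuous_on_subset by auto
next
  case (Suc k)
  then show ?case using Ck_Suc_imp_Ck by blast
qed

lemma Ck_const [simp]: "Ck k (\<lambda>x. c)"
proof (induction k arbitrary: c)
  case (Suc k)
  show ?case by (rule Ck_SucI[OF has_derivative_const Suc])
qed auto

lemma Ck_bounded_linear:
  assumes "bounded_linear L"
  shows "Ck k L"
proof (cases k)
  case 0
  then show ?thesis using assms by (simp add: linear_continuous_on)
next
  case (Suc n)
  then show ?thesis
    using Ck_SucI[of L "\<lambda>_. L" n] bounded_linear_imp_has_derivative[OF assms] by simp
qed

lemma Ck_add:
  assumes "Ck k f" "Ck k g"
  shows "Ck k (\<lambda>x. f x + g x)"
  using assms
proof (induction k arbitrary: f g)
  case 0
  then show ?case by (auto intro: continuous_intros)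
next
  case (Suc k)
  show ?case
    by (rule Ck_SucI[OF has_derivative_add
          [OF Suc.prems[THEN Ck_Suc_has_derivative]]]) (use Suc in simp)
qed

lemma Ck_sum:
  assumes "\<And>i. i \<in> I \<Longrightarrow> Ck k (f i)"
  shows "Ck k (\<lambda>x. \<Sum>i\<in>I. f i x)"
  using assms by (induction I rule: infinite_finite_induct) (auto intro: Ck_add)

text \<open>The product rule mixes differentiated and undifferentiated factors;
  \<open>Ck_Suc_imp_Ck\<close> lowers the latter to level \<open>k\<close> so that the induction
  hypothesis covers both summands.\<close>

lemma Ck_scaleR:
  fixes r :: "'a::euclidean_space \<Rightarrow> real"
  assumes "Ck k r" "Ck k f"
  shows "Ck k (\<lambda>x. r x *\<^sub>R f x)"
  using assms
proof (induction k arbitrary: r f)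
  case 0
  then show ?case by (auto intro: continuous_intros)
next
  case (Suc k)
  show ?case
    by (rule Ck_SucI[OF has_derivative_scaleR
          [OF Suc.prems[THEN Ck_Suc_has_derivative]]])
       (use Suc.IH Suc.prems Suc.prems[THEN Ck_Suc_imp_Ck] in \<open>auto intro!: Ck_add\<close>)
qed

lemma Ck_mult:
  fixes f g :: "'a::euclidean_space \<Rightarrow> real"
  assumes "Ck k f" "Ck k g"
  shows "Ck k (\<lambda>x. f x * g x)"
  using Ck_scaleR[OF assms] by simp

lemma Ck_power:
  fixes f :: "'a::euclidean_space \<Rightarrow> real"
  assumes "Ck k f"
  shows "Ck k (\<lambda>x. f x ^ n)"
  by (induction n) (simp_all add: Ck_mult assms)

lemma linear_eq_sum_Basis:
  fixes L :: "'a::euclidean_space \<Rightarrow> 'b::real_vector"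
  assumes "linear L"
  shows "L v = (\<Sum>b\<in>Basis. (v \<bullet> b) *\<^sub>R L b)"
proof -
  have "L v = L (\<Sum>b\<in>Basis. (v \<bullet> b) *\<^sub>R b)"
    by (simp add: euclidean_representation)
  also have "\<dots> = (\<Sum>b\<in>Basis. (v \<bullet> b) *\<^sub>R L b)"
    by (simp only: linear_sum[OF assms] linear_scale[OF assms])
  finally show ?thesis .
qed

lemma Ck_bounded_linear_compose:
  assumes "bounded_linear L" "Ck k f"
  shows "Ck k (\<lambda>x. L (f x))"
  using assms(2)
proof (induction k arbitrary: f)
  case 0
  then show ?case
    using bounded_linear.continuous_on[OF assms(1)] by auto
next
  case (Suc k)
  show ?case
    by (rule Ck_SucI[OF bounded_linear.has_derivative[OF assms(1)
          Ck_Suc_has_derivative[OF Suc.prems]]]) (use Suc in simp)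
qed

lemma Ck_compose:
  fixes f :: "'b::euclidean_space \<Rightarrow> 'c::real_normed_vector"
    and g :: "'a::euclidean_space \<Rightarrow> 'b"
  assumes "Ck k f" "Ck k g"
  shows "Ck k (\<lambda>x. f (g x))"
  using assms
proof (induction k arbitrary: f g)
  case 0
  then show ?case by (auto intro: continuous_on_compose2)
next
  case (Suc k)
  let ?Df = "\<lambda>y. frechet_derivative f (at y)" and ?Dg = "\<lambda>x. frechet_derivative g (at x)"
  have f: "(f has_derivative ?Df y) (at y)" and g: "(g has_derivative ?Dg x) (at x)" for x y
    using Suc.prems by (auto intro!: Ck_Suc_has_derivative)
  show ?case
  proof (rule Ck_SucI)
    show "((\<lambda>x. f (g x)) has_derivative (\<lambda>v. ?Df (g x) (?Dg x v))) (at x)" for x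
      by (rule has_derivative_compose[OF g f])
    fix v
    \<comment> \<open>The direction \<open>?Dg x v\<close> varies with \<open>x\<close>, whereas
      \<open>Ck\<close> speaks of fixed directions. Expanding it in the basis leaves only the fixed
      directions \<open>b\<close>, with scalar coefficients depending on \<open>x\<close>.\<close>
    have "?Df (g x) (?Dg x v) = (\<Sum>b\<in>Basis. (?Dg x v \<bullet> b) *\<^sub>R ?Df (g x) b)" for x
      by (rule linear_eq_sum_Basis[OF has_derivative_linear[OF f]])
    moreover have "Ck k (\<lambda>x. \<Sum>b\<in>Basis. (?Dg x v \<bullet> b) *\<^sub>R ?Df (g x) b)"
      by (intro Ck_sum Ck_scaleR Suc.IH Ck_bounded_linear_compose[OF bounded_linear_inner_left])
         (use Suc.prems Ck_Suc_imp_Ck in auto)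
    ultimately show "Ck k (\<lambda>x. ?Df (g x) (?Dg x v))" by presburger
  qed
qed

text \<open>Differentiation lowers the exponent by one, so the induction is over all exponents
  \<open>a\<close> at once.\<close>

lemma Ck_powr:
  fixes f :: "'a::euclidean_space \<Rightarrow> real"
  assumes "Ck k f" "\<And>x. f x > 0"
  shows "Ck k (\<lambda>x. f x powr a)"
  using assms
proof (induction k arbitrary: f a)
  case 0
  then show ?case by (auto intro!: continuous_intros simp: less_imp_neq[symmetric])
next
  case (Suc k)
  let ?D = "\<lambda>x. frechet_derivative f (at x)"
  show ?case
  proof (rule Ck_SucI)
    fix x
    have "((\<lambda>t. t powr a) has_derivative (\<lambda>h. a * f x powr (a - 1) * h)) (at (f x))"
      using has_real_derivative_powr[of "f x" a] Suc.prems(2)[of x]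
      by (simp add: has_field_derivative_def)
    from has_derivative_compose[OF Ck_Suc_has_derivative[OF Suc.prems(1)] this]
    show "((\<lambda>x. f x powr a) has_derivative (\<lambda>v. a * f x powr (a - 1) * ?D x v)) (at x)" .
  next
    show "Ck k (\<lambda>x. a * f x powr (a - 1) * ?D x v)" for v
      using Suc.prems Ck_Suc_imp_Ck[OF Suc.prems(1)] by (intro Ck_mult Suc.IH) auto
  qed
qed

lemma Ck_vector_2:
  fixes f g :: "'a::euclidean_space \<Rightarrow> real"
  assumes "Ck k f" "Ck k g"
  shows "Ck k (\<lambda>x. vector [f x, g x] :: real^2)"
proof -
  have "(\<lambda>x. vector [f x, g x] :: real^2)
      = (\<lambda>x. f x *\<^sub>R axis 1 1 + g x *\<^sub>R axis 2 1)"
    by (auto simp: vec_eq_iff forall_2 axis_def)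
  then show ?thesis
    using assms by (simp add: Ck_add Ck_scaleR)
qed

text \<open>Differentiation under the integral sign: the derivative in direction \<open>v\<close> is
  again a parameter integral, of the partial derivative \<open>D\<close>, to which the induction
  hypothesis applies.\<close>

lemma Ck_integral:
  fixes H :: "'a::euclidean_space \<times> 'b::euclidean_space \<Rightarrow> 'c::banach"
  assumes "Ck k H"
  shows "Ck k (\<lambda>x. integral (cbox a b) (\<lambda>t. H (x, t)))"
  using assms
proof (induction k arbitrary: H)
  case 0
  have "continuous_on (UNIV \<times> cbox a b) (\<lambda>(x, t). H (x, t))"
    using Ck_imp_continuous_on[OF 0] by simp
  from integral_continuous_on_param[OF this] show ?case by simp
next
  case (Suc k)
  define D where "D x t v = frechet_derivative H (at (x, t)) (v, 0)" for x t v
  have HD: "((\<lambda>x. H (x, t)) has_derivative D x t) (at x)" for x t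
  proof -
    have "((\<lambda>x. (x, t)) has_derivative (\<lambda>v. (v, 0))) (at x)"
      by (intro derivative_eq_intros) auto
    from has_derivative_compose[OF this Ck_Suc_has_derivative[OF Suc.prems]]
    show ?thesis by (simp add: D_def[abs_def])
  qed
  have Ck_D: "Ck k (\<lambda>z. D (fst z) (snd z) v)" for v
    using Suc.prems by (simp add: D_def)
  have blinfun: "blinfun_apply (Blinfun (D x t)) = D x t" for x t
    using has_derivative_bounded_linear[OF HD] by (rule bounded_linear_Blinfun_apply)
  \<comment> \<open>The Leibniz rule wants a derivative continuous in operator norm; on a Euclidean
    domain this reduces to continuity in each direction.\<close>
  have cont: "continuous_on (UNIV \<times> cbox a b) (\<lambda>(x, t). Blinfun (D x t))"
    by (intro continuous_on_blinfun_componentwise)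
       (use Ck_imp_continuous_on[OF Ck_D] in \<open>simp add: split_beta blinfun\<close>)
  show ?case
  proof (rule Ck_SucI)
    fix x
    show "((\<lambda>x. integral (cbox a b) (\<lambda>t. H (x, t))) has_derivative
           blinfun_apply (integral (cbox a b) (\<lambda>t. Blinfun (D x t)))) (at x)"
      by (rule leibniz_rule[where U=UNIV, OF _ _ cont])
         (auto simp: blinfun HD intro!: integrable_continuous
           continuous_on_compose2[OF Ck_imp_continuous_on[OF Suc.prems, of UNIV]] continuous_intros)
  next
    fix v
    have "(\<lambda>t. Blinfun (D x t)) integrable_on cbox a b" for x
      by (rule integrable_continuous)
         (rule continuous_on_compose2[OF cont, of _ "Pair x", simplified], auto intro: continuous_intros)
    then have "blinfun_apply (integral (cbox a b) (\<lambda>t. Blinfun (D x t))) v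
        = integral (cbox a b) (\<lambda>t. D x t v)" for x
      by (simp add: blinfun_apply_integral blinfun)
    then show "Ck k (\<lambda>x. blinfun_apply (integral (cbox a b) (\<lambda>t. Blinfun (D x t))) v)"
      using Suc.IH[OF Ck_D, of v] by simp
  qed
qed

subsection \<open>Weak gradients of \<open>C\<^sup>1\<close> maps and integrability of power decay\<close>

lemma continuous_imp_borel_measurable_lebesgue:
  assumes "continuous_on UNIV f"
  shows "f \<in> borel_measurable lebesgue"
  using borel_measurable_continuous_onI[OF assms] by (intro measurable_completion) simp

lemma continuous_imp_locally_integrable:
  assumes "continuous_on UNIV f"
  shows "locally_integrable f"
  unfolding locally_integrable_def set_integrable_def
proof (intro allI impI)
  fix K :: "'a set"
  assume "compact K"
  then have "integrable lborel (\<lambda>x. indicator K x *\<^sub>R f x)"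
    using assms by (intro borel_integrable_compact) (auto intro: continuous_on_subset)
  then show "integrable lebesgue (\<lambda>x. indicator K x *\<^sub>R f x)"
    by (simp add: integrable_completion borel_measurable_integrable)
qed

text \<open>Bridges three integrals: weak gradients use \<open>lebesgue\<close>, translation
  invariance is stated for \<open>lborel\<close>, and the Leibniz rule concerns the gauge integral
  over a box.\<close>

lemma continuous_compact_support_integrable:
  fixes g :: "'a::euclidean_space \<Rightarrow> real"
  assumes "continuous_on UNIV g" "compact K" "\<And>x. x \<notin> K \<Longrightarrow> g x = 0"
  shows "integrable lborel g" "integrable lebesgue g"
    "(LINT x|lebesgue. g x) = (LINT x|lborel. g x)" "(LINT x|lborel. g x) = integral K g"
proof -
  have eq: "(\<lambda>x. indicator K x *\<^sub>R g x) = g"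
    using assms(3) by (auto simp: fun_eq_iff indicator_def)
  have K: "set_integrable lborel K g"
    unfolding set_integrable_def
    using assms by (intro borel_integrable_compact) (auto intro: continuous_on_subset)
  with eq show int: "integrable lborel g"
    by (simp add: set_integrable_def)
  show "integrable lebesgue g" "(LINT x|lebesgue. g x) = (LINT x|lborel. g x)"
    using int by (simp_all add: integrable_completion integral_completion borel_measurable_integrable)
  show "(LINT x|lborel. g x) = integral K g"
    using set_borel_integral_eq_integral(2)[OF K] eq by (simp add: set_lebesgue_integral_def)
qed

lemma lborel_integral_translation:
  fixes g :: "'a::euclidean_space \<Rightarrow> real"
  assumes "continuous_on UNIV g"
  shows "(LINT x|lborel. g (x + c)) = (LINT x|lborel. g x)"
proof -
  have g: "g \<in> borel_measurable borel"
    using assms by (rule borel_measurable_continuous_onI)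
  have "(LINT x|lborel. g x) = (LINT x|distr lborel borel ((+) c). g x)"
    by (simp add: lborel_distr_plus)
  also have "\<dots> = (LINT x|lborel. g (c + x))"
    using g by (subst integral_distr) auto
  finally show ?thesis by (simp add: add.commute)
qed

lemma frechet_derivative_eq_0_outside:
  assumes "closed K" "\<And>x. x \<notin> K \<Longrightarrow> h x = 0" "x \<notin> K"
  shows "frechet_derivative h (at x) v = 0"
proof -
  have "(h has_derivative (\<lambda>_. 0)) (at x)"
    by (rule has_derivative_transform_within_open[OF has_derivative_const, of "- K"])
       (use assms in auto)
  then show ?thesis
    using frechet_derivative_at by (metis (no_types))
qed

text \<open>
  The translates \<open>h (\<cdot> + t e)\<close> all have the same integral; differentiate under the integral sign
  at \<open>t = 0\<close>.
\<close>

lemma integral_directional_derivative_eq_0: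
  fixes h :: "'a::euclidean_space \<Rightarrow> real"
  assumes "Ck (Suc 0) h" "compact K" and supp: "\<And>x. x \<notin> K \<Longrightarrow> h x = 0"
  shows "(LINT x|lebesgue. frechet_derivative h (at x) e) = 0"
proof -
  let ?D = "\<lambda>x. frechet_derivative h (at x) e"
  have cont: "continuous_on UNIV h" "continuous_on UNIV ?D"
    using assms(1) Ck_imp_continuous_on[OF assms(1)] by auto
  \<comment> \<open>This set collects every point that some translation by
    \<open>t *\<^sub>R e\<close> with \<open>t\<close> in \<open>{-1..1}\<close> carries into
    \<open>K\<close>. A single box around it therefore contains the supports of all these translates
    of \<open>h\<close>.\<close>
  have "compact ((\<lambda>(x, t). x - t *\<^sub>R e) ` (K \<times> {-1..1}))"
    using assms(2) by (intro compact_continuous_image compact_Times)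
      (auto simp: split_beta intro!: continuous_intros)
  then obtain c where c: "(\<lambda>(x, t). x - t *\<^sub>R e) ` (K \<times> {-1..1}) \<subseteq> cbox (-c) c"
    using bounded_subset_cbox_symmetric compact_imp_bounded by metis
  have outside: "h (x + t *\<^sub>R e) = 0" if "x \<notin> cbox (-c) c" "t \<in> {-1..1}" for x t
  proof (rule supp, rule notI)
    assume "x + t *\<^sub>R e \<in> K"
    then have "x \<in> (\<lambda>(x, t). x - t *\<^sub>R e) ` (K \<times> {-1..1})"
      using that(2) by (auto intro!: image_eqI[where x="(x + t *\<^sub>R e, t)"])
    then show False using c that(1) by blast
  qed
  have K_sub: "K \<subseteq> cbox (-c) c"
    using c by force
  define F where "F t = integral (cbox (-c) c) (\<lambda>x. h (x + t *\<^sub>R e))" for t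
  have F: "F t = (LINT x|lborel. h x)" if "t \<in> {-1..1}" for t
  proof -
    have "F t = (LINT x|lborel. h (x + t *\<^sub>R e))"
      unfolding F_def using outside that
      by (intro continuous_compact_support_integrable(4)[symmetric])
         (auto intro!: continuous_intros continuous_on_compose2[OF cont(1)])
    then show ?thesis
      using lborel_integral_translation[OF cont(1)] by simp
  qed
  have deriv: "((\<lambda>t. h (x + t *\<^sub>R e)) has_real_derivative ?D (x + t *\<^sub>R e)) (at t)" for x t
  proof -
    have "((\<lambda>t. x + t *\<^sub>R e) has_derivative (\<lambda>d. d *\<^sub>R e)) (at t)"
      by (auto intro!: derivative_eq_intros)
    note has_derivative_compose[OF this Ck_Suc_has_derivative[OF assms(1)]]
    moreover have "linear (frechet_derivative h (at (x + t *\<^sub>R e)))"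
      by (rule has_derivative_linear[OF Ck_Suc_has_derivative[OF assms(1)]])
    ultimately show ?thesis
      by (simp add: has_field_derivative_def linear_scale mult_commute_abs)
  qed
  have "(F has_real_derivative integral (cbox (-c) c) (\<lambda>x. ?D (x + 0 *\<^sub>R e))) (at 0 within {-1..1})"
    unfolding F_def
    by (rule leibniz_rule_field_derivative)
       (auto simp: split_beta intro!: has_field_derivative_at_within[OF deriv] integrable_continuous
          continuous_on_compose2[OF cont(1)] continuous_on_compose2[OF cont(2)] continuous_intros)
  moreover have "at 0 within {-1..1} = at (0::real)"
    by (rule at_within_interior) (simp add: interior_atLeastAtMost_real)
  ultimately have "(F has_real_derivative integral (cbox (-c) c) ?D) (at 0)"
    by simp
  \<comment> \<open>\<open>F\<close> is constant near 0 by translation invariance, so its derivative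
    computed above must vanish.\<close>
  moreover have "(F has_real_derivative 0) (at 0)"
    by (rule has_field_derivative_transform_within_open[where
          f="\<lambda>_. LINT x|lborel. h x" and S="{-1<..<1}"]) (auto simp: F)
  ultimately have "integral (cbox (-c) c) ?D = 0"
    by (rule DERIV_unique)
  moreover have D_outside: "?D x = 0" if "x \<notin> cbox (-c) c" for x
    by (rule frechet_derivative_eq_0_outside[OF compact_imp_closed[OF assms(2)] supp])
       (use that K_sub in auto)
  ultimately show ?thesis
    using continuous_compact_support_integrable(3,4)[OF cont(2) compact_cbox D_outside] by simp
qed

text \<open>Integration by parts: each product of a component of \<open>u\<close> with a test
  function is \<open>C\<^sup>1\<close> with compact support, so its directional derivatives
  integrate to 0, and the product rule splits that integral.\<close>

lemma Ck1_has_weak_gradient: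
  fixes u :: "real ^ 'n \<Rightarrow> real ^ 'm"
  assumes u: "Ck (Suc 0) u"
  shows "continuous_on UNIV (\<lambda>x. jacobian u (at x))"
    and "has_weak_gradient u (\<lambda>x. jacobian u (at x))"
proof -
  let ?D = "\<lambda>x. frechet_derivative u (at x)"
  have cont: "continuous_on UNIV (\<lambda>x. ?D x v)" for v
    using u by simp
  show cont_J: "continuous_on UNIV (\<lambda>x. jacobian u (at x))"
    unfolding jacobian_def matrix_def
    by (intro continuous_on_vec_lambda continuous_on_component cont)
  have "(LINT x|lebesgue. u x $ i * frechet_derivative \<phi> (at x) (axis j 1)) =
      - (LINT x|lebesgue. jacobian u (at x) $ i $ j * \<phi> x)" if "\<phi> \<in> Cc_infinity" for \<phi> i j
  proof -
    define K where "K = closure {x. \<phi> x \<noteq> 0}"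
    have K: "compact K" and \<phi>: "Ck (Suc 0) \<phi>"
      using that by (auto simp: K_def Cc_infinity_def smooth_def)
    have supp: "\<phi> x = 0" if "x \<notin> K" for x
      using that closure_subset[of "{x. \<phi> x \<noteq> 0}"] by (auto simp: K_def)
    let ?e = "axis j 1 :: real^'n"
    have ui: "((\<lambda>x. u x $ i) has_derivative (\<lambda>v. ?D x v $ i)) (at x)" for x
      by (rule bounded_linear.has_derivative[OF bounded_linear_vec_nth Ck_Suc_has_derivative[OF u]])
    have ui_Ck: "Ck (Suc 0) (\<lambda>x. u x $ i)"
      using Ck_bounded_linear_compose[OF bounded_linear_vec_nth u] .
    have "((\<lambda>x. u x $ i * \<phi> x) has_derivative
        (\<lambda>v. u x $ i * frechet_derivative \<phi> (at x) v + ?D x v $ i * \<phi> x)) (at x)" for x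
      by (rule has_derivative_mult[OF ui Ck_Suc_has_derivative[OF \<phi>]])
    from frechet_derivative_at[OF this, symmetric]
    have "frechet_derivative (\<lambda>x. u x $ i * \<phi> x) (at x) ?e
        = u x $ i * frechet_derivative \<phi> (at x) ?e + jacobian u (at x) $ i $ j * \<phi> x" for x
      by (simp add: jacobian_def matrix_def)
    moreover have "(LINT x|lebesgue. frechet_derivative (\<lambda>x. u x $ i * \<phi> x) (at x) ?e) = 0"
      by (rule integral_directional_derivative_eq_0[OF Ck_mult[OF ui_Ck \<phi>] K]) (simp add: supp)
    moreover have "integrable lebesgue (\<lambda>x. u x $ i * frechet_derivative \<phi> (at x) ?e)"
    proof (rule continuous_compact_support_integrable(2)[OF _ K])
      show "continuous_on UNIV (\<lambda>x. u x $ i * frechet_derivative \<phi> (at x) ?e)"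
        using \<phi> by (intro continuous_on_mult Ck_imp_continuous_on[OF ui_Ck]) simp
    qed (use frechet_derivative_eq_0_outside[OF compact_imp_closed[OF K] supp] in simp)
    moreover have "integrable lebesgue (\<lambda>x. jacobian u (at x) $ i $ j * \<phi> x)"
    proof (rule continuous_compact_support_integrable(2)[OF _ K])
      show "continuous_on UNIV (\<lambda>x. jacobian u (at x) $ i $ j * \<phi> x)"
        by (intro continuous_on_mult continuous_on_component cont_J Ck_imp_continuous_on[OF \<phi>])
    qed (simp add: supp)
    ultimately show ?thesis by simp
  qed
  then show "has_weak_gradient u (\<lambda>x. jacobian u (at x))"
    unfolding has_weak_gradient_def
    by (intro conjI ballI allI continuous_imp_locally_integrable Ck_imp_continuous_on[OF u] cont_J)
qed

text \<open>Lebesgue measure is the image of the product of one-dimensional measures under the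
  coordinate map, so integrability of a product of one-variable functions passes from the
  factors.\<close>

lemma integrable_lborel_prod_Basis:
  fixes f :: "'a::euclidean_space \<Rightarrow> real \<Rightarrow> real"
  assumes "\<And>b. b \<in> Basis \<Longrightarrow> integrable lborel (f b)"
  shows "integrable lborel (\<lambda>x::'a. \<Prod>b\<in>Basis. f b (x \<bullet> b))"
proof -
  interpret product_sigma_finite "\<lambda>_::'a. lborel :: real measure" ..
  have [measurable]: "f b \<in> borel_measurable borel" if "b \<in> Basis" for b
    using borel_measurable_integrable[OF assms[OF that]] by simp
  have "integrable (\<Pi>\<^sub>M b\<in>(Basis::'a set). lborel) (\<lambda>x. \<Prod>b\<in>Basis. f b (x b))"
    using assms by (intro product_integrable_prod) auto
  moreover have "(\<lambda>x. \<Prod>b\<in>Basis. f b ((\<Sum>c\<in>Basis. x c *\<^sub>R c) \<bullet> b)) = (\<lambda>x. \<Prod>b\<in>(Basis::'a set). f b (x b))"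
    by (intro ext prod.cong) (auto simp: inner_sum_left_Basis)
  moreover have "(\<lambda>x. \<Sum>c\<in>(Basis::'a set). x c *\<^sub>R c) \<in> (\<Pi>\<^sub>M b\<in>Basis. lborel) \<rightarrow>\<^sub>M borel"
    by measurable
  moreover have "(\<lambda>x::'a. \<Prod>b\<in>Basis. f b (x \<bullet> b)) \<in> borel_measurable borel"
    by measurable
  ultimately have "integrable (distr (\<Pi>\<^sub>M b\<in>(Basis::'a set). lborel) borel (\<lambda>x. \<Sum>c\<in>Basis. x c *\<^sub>R c))
      (\<lambda>x::'a. \<Prod>b\<in>Basis. f b (x \<bullet> b))"
    by (simp only: integrable_distr_eq)
  then show ?thesis
    by (simp only: lborel_eq[symmetric])
qed

text \<open>The majorant is the tail of \<open>\<bar>x\<bar> powr (-2*a)\<close> on both sides plus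
  the indicator of \<open>{-1..1}\<close>; the tails converge because
  \<open>-2*a < -1\<close>.\<close>

lemma integrable_lborel_powr_decay_real:
  fixes a :: real
  assumes "a > 1/2"
  shows "integrable lborel (\<lambda>x::real. (1 + x\<^sup>2) powr (-a))"
proof -
  have [measurable]: "(\<lambda>x::real. (1 + x\<^sup>2) powr (-a)) \<in> borel_measurable borel"
    by measurable
  have "set_integrable lborel {1..} (\<lambda>x. x powr (-2*a))"
  proof -
    have "(\<lambda>x. x powr (-2*a)) integrable_on {1..}"
      using has_integral_powr_to_inf[of "-2*a" 1] assms by auto
    then have "set_integrable lebesgue {1..} (\<lambda>x. x powr (-2*a))"
      by (intro nonnegative_absolutely_integrable_1) auto
    then show ?thesis
      unfolding set_integrable_def by (subst (asm) integrable_completion) auto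
  qed
  then have right: "integrable lborel (\<lambda>x. indicator {1..} x *\<^sub>R x powr (-2*a))" (is "integrable _ ?r")
    by (simp add: set_integrable_def)
  then have left: "integrable lborel (\<lambda>x. ?r (- x))"
    using lborel_integrable_real_affine[of ?r "-1" 0] by simp
  have mid: "integrable lborel (indicator {-1..1} :: real \<Rightarrow> real)"
    by (simp add: integrable_indicator_iff)
  show ?thesis
  proof (rule Bochner_Integration.integrable_bound[OF Bochner_Integration.integrable_add[OF
        Bochner_Integration.integrable_add[OF right left] mid]])
    show "AE x in lborel. norm ((1 + x\<^sup>2) powr (-a))
        \<le> norm (?r x + ?r (- x) + indicator {-1..1} x)"
    proof (rule AE_I2)
      fix x :: real
      have *: "(1 + x\<^sup>2) powr (-a) \<le> \<bar>x\<bar> powr (-2*a)" if "x \<noteq> 0"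
      proof -
        have "(1 + x\<^sup>2) powr (-a) \<le> (\<bar>x\<bar> ^ 2) powr (-a)"
          using that assms by (intro powr_mono2') auto
        also have "\<bar>x\<bar> ^ 2 = \<bar>x\<bar> powr 2"
          by simp
        also have "(\<bar>x\<bar> powr 2) powr (-a) = \<bar>x\<bar> powr (-2*a)"
          by (simp only: powr_powr) simp
        finally show ?thesis .
      qed
      moreover have "(1 + x\<^sup>2) powr (-a) \<le> 1"
        using powr_mono2'[of "-a" 1 "1 + x\<^sup>2"] assms by simp
      ultimately show "norm ((1 + x\<^sup>2) powr (-a)) \<le> norm (?r x + ?r (- x) + indicator {-1..1} x)"
        by (cases "x = 0") (auto simp: indicator_def)
    qed
  qed simp
qed

text \<open>
  Since \<open>1 + \<bar>x\<bar>\<^sup>2\<close> dominates each \<open>1 + x\<^sub>b\<^sup>2\<close>, it dominates their geometric mean, which reduces the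
  claim to dimension one.
\<close>

lemma integrable_lborel_powr_decay:
  fixes a :: real
  assumes "2 * a > DIM('a)"
  shows "integrable lborel (\<lambda>x::'a::euclidean_space. (1 + (norm x)\<^sup>2) powr (-a))"
proof -
  let ?n = "real DIM('a)"
  have n: "?n > 0" by simp
  have "a / ?n > 1/2" using assms n by (simp add: field_simps)
  then have int: "integrable lborel (\<lambda>x::'a. \<Prod>b\<in>Basis. (1 + (x \<bullet> b)\<^sup>2) powr (- (a / ?n)))"
    by (intro integrable_lborel_prod_Basis integrable_lborel_powr_decay_real)
  have le: "(1 + (norm x)\<^sup>2) powr (-a) \<le> (\<Prod>b\<in>Basis. (1 + (x \<bullet> b)\<^sup>2) powr (- (a / ?n)))" for x :: 'a
  proof -
    have "(1 + (norm x)\<^sup>2) powr (-a) = (\<Prod>b\<in>(Basis::'a set). (1 + (norm x)\<^sup>2) powr (- (a / ?n)))"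
      by (simp add: powr_power add_nonneg_eq_0_iff)
    also have "\<dots> \<le> (\<Prod>b\<in>Basis. (1 + (x \<bullet> b)\<^sup>2) powr (- (a / ?n)))"
    proof (intro prod_mono conjI powr_mono2')
      fix b :: 'a assume "b \<in> Basis"
      then have "\<bar>x \<bullet> b\<bar> \<le> norm x" by (rule Basis_le_norm)
      then show "1 + (x \<bullet> b)\<^sup>2 \<le> 1 + (norm x)\<^sup>2"
        using power_mono[of "\<bar>x \<bullet> b\<bar>" "norm x" 2] by simp
    qed (use assms n in \<open>auto simp: add_pos_nonneg\<close>)
    finally show ?thesis .
  qed
  have "(\<lambda>x::'a. (1 + (norm x)\<^sup>2) powr (-a)) \<in> borel_measurable lborel"
    by measurable
  then show ?thesis
  proof (rule Bochner_Integration.integrable_bound[OF int])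
    show "AE x::'a in lborel. norm ((1 + (norm x)\<^sup>2) powr (-a))
        \<le> norm (\<Prod>b\<in>Basis. (1 + (x \<bullet> b)\<^sup>2) powr (- (a / ?n)))"
    proof (rule AE_I2)
      fix x :: 'a
      show "norm ((1 + (norm x)\<^sup>2) powr (-a))
          \<le> norm (\<Prod>b\<in>Basis. (1 + (x \<bullet> b)\<^sup>2) powr (- (a / ?n)))"
        unfolding real_norm_def abs_of_nonneg[OF powr_ge_zero]
        by (rule order.trans[OF le abs_ge_self])
    qed
  qed
qed

subsection \<open>The potential along the fan\<close>

text \<open>By substitution the expression is \<open>G y - G a\<close> for an antiderivative
  \<open>G\<close> of \<open>g\<close>, whichever side of \<open>a\<close> the point
  \<open>y\<close> lies on.\<close>

lemma has_real_derivative_scaled_integral: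
  fixes g :: "real \<Rightarrow> real"
  assumes "continuous_on UNIV g"
  shows "((\<lambda>y. (y - a) * integral (cbox 0 1) (\<lambda>\<tau>. g (a + \<tau> * (y - a)))) has_real_derivative g y) (at y)"
proof -
  have "isCont g x" for x
    using assms by (simp add: continuous_on_eq_continuous_at)
  then obtain G where G: "(G has_real_derivative g x) (at x)" for x
    using einterval_antiderivative[of "-\<infinity>" "\<infinity>" g]
    by (auto simp: has_real_derivative_iff_has_vector_derivative)
  have "(y - a) * integral (cbox 0 1) (\<lambda>\<tau>. g (a + \<tau> * (y - a))) = G y - G a" for y
  proof -
    have "((\<lambda>\<tau>. (y - a) * g (a + \<tau> * (y - a))) has_integral
        G (a + 1 * (y - a)) - G (a + 0 * (y - a))) {0..1}"
    proof (rule fundamental_theorem_of_calculus)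
      fix \<tau> :: real
      have "((\<lambda>\<tau>. a + \<tau> * (y - a)) has_real_derivative y - a) (at \<tau> within {0..1})"
        by (auto intro!: derivative_eq_intros)
      from DERIV_chain2[OF G this]
      show "((\<lambda>\<tau>. G (a + \<tau> * (y - a))) has_vector_derivative (y - a) * g (a + \<tau> * (y - a)))
          (at \<tau> within {0..1})"
        by (simp add: has_real_derivative_iff_has_vector_derivative mult.commute)
    qed simp
    then show ?thesis
      by (simp add: integral_unique flip: integral_mult_right)
  qed
  then show ?thesis
    using DERIV_diff[OF G[of y] DERIV_const[of "G a"]] by simp
qed

lemma vector_2_eq_axis: "vector [a, b] = a *\<^sub>R axis 1 1 + b *\<^sub>R (axis 2 1 :: real^2)"
  by (simp add: vec_eq_iff forall_2 axis_def)

lemma vector_2_components [simp]: "vector [z $ 1, z $ 2] = (z :: real^2)"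
  by (simp add: vec_eq_iff forall_2)

lemma has_derivative_vector_2:
  assumes "(f has_derivative f') F" "(g has_derivative g') F"
  shows "((\<lambda>x. vector [f x, g x] :: real^2) has_derivative (\<lambda>v. vector [f' v, g' v])) F"
  unfolding vector_2_eq_axis using assms by (auto intro!: derivative_eq_intros)

lemma linear_vector_2:
  assumes "linear (L :: real^2 \<Rightarrow> real)"
  shows "L (vector [a, b]) = a * L (axis 1 1) + b * L (axis 2 1)"
  unfolding vector_2_eq_axis by (simp add: linear_add[OF assms] linear_scale[OF assms])

lemma norm_sq_vec_2: "(norm z)\<^sup>2 = (z $ 1)\<^sup>2 + (z $ 2)\<^sup>2" for z :: "real^2"
  by (simp add: norm_vec_def L2_set_def sum_2)

text \<open>Lets one-variable uniqueness of derivatives identify the values of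
  \<open>frechet_derivative V\<close> on the axes.\<close>

lemma partial_derivatives_vector_2:
  fixes V :: "real^2 \<Rightarrow> real"
  assumes "Ck (Suc 0) V"
  shows "((\<lambda>s. V (vector [s, y])) has_real_derivative
            frechet_derivative V (at (vector [s, y])) (axis 1 1)) (at s)"
    and "((\<lambda>y. V (vector [s, y])) has_real_derivative
            frechet_derivative V (at (vector [s, y])) (axis 2 1)) (at y)"
proof -
  let ?D = "frechet_derivative V (at (vector [s, y]))"
  have V: "(V has_derivative ?D) (at (vector [s, y]))"
    by (rule Ck_Suc_has_derivative[OF assms])
  have D: "?D (vector [a, b]) = a * ?D (axis 1 1) + b * ?D (axis 2 1)" for a b
    by (rule linear_vector_2[OF has_derivative_linear[OF V]])
  show "((\<lambda>s. V (vector [s, y])) has_real_derivative ?D (axis 1 1)) (at s)"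
    using has_derivative_compose[OF has_derivative_vector_2[OF has_derivative_ident has_derivative_const] V]
    by (simp add: has_field_derivative_def D mult_commute_abs)
  show "((\<lambda>y. V (vector [s, y])) has_real_derivative ?D (axis 2 1)) (at y)"
    using has_derivative_compose[OF has_derivative_vector_2[OF has_derivative_const has_derivative_ident] V]
    by (simp add: has_field_derivative_def D mult_commute_abs)
qed

text \<open>Projection onto a horizontal strip. Invariance under it encodes that a function is
  constant in the second variable above the strip and, with a possibly different value, below
  it.\<close>

definition clamp_snd :: "real \<Rightarrow> real^2 \<Rightarrow> real^2"
  where "clamp_snd R q = vector [q $ 1, max (-R) (min R (q $ 2))]"

text \<open>Where \<open>h\<close> can be nonzero, clamping moves the point into a compact square
  without changing the value, and a continuous function is bounded there.\<close>

lemma bounded_of_clamp_snd: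
  fixes h :: "real^2 \<Rightarrow> real"
  assumes cont: "continuous_on UNIV h" and "R > 0"
    and supp: "\<And>q. \<bar>q $ 1\<bar> > R \<Longrightarrow> h q = 0"
    and clamp: "\<And>q. h (clamp_snd R q) = h q"
  obtains C where "C \<ge> 0" "\<And>q. \<bar>h q\<bar> \<le> C"
proof -
  let ?K = "cbox (vector [-R, -R]) (vector [R, R] :: real^2)"
  have "bounded (h ` ?K)"
    using cont by (intro compact_imp_bounded compact_continuous_image)
      (auto intro: continuous_on_subset)
  then obtain C where C: "C > 0" "\<And>q. q \<in> ?K \<Longrightarrow> \<bar>h q\<bar> \<le> C"
    by (auto simp: bounded_pos)
  have "\<bar>h q\<bar> \<le> C" for q
  proof (cases "\<bar>q $ 1\<bar> > R")
    case True
    then show ?thesis using supp C(1) by simp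
  next
    case False
    then have "clamp_snd R q \<in> ?K"
      using \<open>R > 0\<close> by (auto simp: mem_box_cart clamp_snd_def forall_2)
    then show ?thesis using C(2) clamp by metis
  qed
  then show thesis using that C(1) less_imp_le by blast
qed

text \<open>The Japanese bracket; at \<open>y\<close> it is the weight \<open>w(y)\<close> of the
  outline.\<close>

definition bracket :: "real \<Rightarrow> real"
  where "bracket t = sqrt (1 + t\<^sup>2)"

lemma bracket_sq: "(bracket t)\<^sup>2 = 1 + t\<^sup>2"
  by (simp add: bracket_def)

lemma bracket_ge_1: "bracket t \<ge> 1"
  by (simp add: bracket_def)

lemma bracket_pos [simp]: "bracket t > 0"
  using bracket_ge_1[of t] by linarith

lemma bracket_neq_0 [simp]: "bracket t \<noteq> 0"
  using bracket_pos[of t] by linarith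

lemma abs_le_bracket: "\<bar>t\<bar> \<le> bracket t"
  unfolding bracket_def by (rule real_le_rsqrt) simp

text \<open>Translates the weights natural in the coordinates \<open>(s, y)\<close> into the radial
  weight of the plane.\<close>

lemma bracket_mult: "bracket (x / bracket y) * bracket y = sqrt (1 + x\<^sup>2 + y\<^sup>2)"
proof -
  have "(bracket (x / bracket y) * bracket y)\<^sup>2 = 1 + x\<^sup>2 + y\<^sup>2"
    unfolding power_mult_distrib
    by (simp add: bracket_sq power_divide field_simps add_nonneg_eq_0_iff)
  then show ?thesis
    by (metis real_sqrt_unique mult_nonneg_nonneg bracket_pos less_imp_le)
qed

text \<open>The vector is the point of the plane with fan coordinates \<open>(s, t)\<close>. The
  bounds turn the support of \<open>f\<close> in a ball into a support condition on \<open>s\<close>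
  and \<open>t\<close>.\<close>

lemma le_norm_vector_bracket:
  "\<bar>s\<bar> \<le> norm (vector [s * bracket t, t] :: real^2)"
  "\<bar>t\<bar> \<le> norm (vector [s * bracket t, t] :: real^2)"
proof -
  have "\<bar>s\<bar> \<le> \<bar>s\<bar> * bracket t"
    using mult_left_mono[OF bracket_ge_1, of "\<bar>s\<bar>" t] by simp
  then show "\<bar>s\<bar> \<le> norm (vector [s * bracket t, t] :: real^2)"
    using component_le_norm_cart[of "vector [s * bracket t, t] :: real^2" 1]
    by (simp add: abs_mult abs_of_pos)
  show "\<bar>t\<bar> \<le> norm (vector [s * bracket t, t] :: real^2)"
    using component_le_norm_cart[of "vector [s * bracket t, t] :: real^2" 2] by simp
qed

lemma has_real_derivative_bracket: "(bracket has_real_derivative t / bracket t) (at t)"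
proof -
  have "1 + t\<^sup>2 > 0" by (simp add: add_pos_nonneg)
  then show ?thesis
    unfolding bracket_def[abs_def] by (auto intro!: derivative_eq_intros simp: field_simps)
qed

lemma Ck_divide:
  fixes f g :: "'a::euclidean_space \<Rightarrow> real"
  assumes "Ck k f" "Ck k g" "\<And>x. g x > 0"
  shows "Ck k (\<lambda>x. f x / g x)"
proof -
  have "(\<lambda>x. f x / g x) = (\<lambda>x. f x * g x powr (-1))"
    using assms(3) by (simp add: fun_eq_iff powr_minus_divide less_imp_le)
  moreover have "Ck k (\<lambda>x. f x * g x powr (-1))"
    by (intro Ck_mult Ck_powr assms)
  ultimately show ?thesis by (simp only:)
qed

lemma Ck_bracket:
  assumes "Ck k f"
  shows "Ck k (\<lambda>x. bracket (f x))"
proof -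
  have "(\<lambda>x. bracket (f x)) = (\<lambda>x. (1 + (f x)\<^sup>2) powr (1/2))"
    by (simp add: fun_eq_iff bracket_def powr_half_sqrt)
  moreover have "Ck k (\<lambda>x. (1 + (f x)\<^sup>2) powr (1/2))"
    by (intro Ck_powr Ck_add Ck_power assms) (auto simp: add_pos_nonneg)
  ultimately show ?thesis by simp
qed

lemma Ck_vec_nth: "Ck k (\<lambda>z :: real^'n. z $ i)"
  by (rule Ck_bounded_linear[OF bounded_linear_vec_nth])

lemmas Ck_intros = Ck_const Ck_add Ck_mult Ck_power Ck_divide Ck_bracket Ck_vec_nth Ck_vector_2

text \<open>Supplies the second component of the map in the coordinates \<open>(s, y)\<close>. The
  factor \<open>bracket (q $ 1) ^ 3\<close> offsets the derivative of \<open>s / bracket s\<close>,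
  and \<open>bracket (q $ 2)\<close> offsets the \<open>x\<close>-derivative of
  \<open>s\<close>.\<close>

lemma exists_fan_potential:
  fixes f :: "real^2 \<Rightarrow> real"
  assumes f: "\<And>k. Ck k f" and "R > 0" and supp: "\<And>z. norm z \<ge> R \<Longrightarrow> f z = 0"
  obtains V :: "real^2 \<Rightarrow> real" where
    "\<And>k. Ck k V"
    "\<And>q. frechet_derivative V (at q) (axis 2 1) =
        bracket (q $ 1) ^ 3 * (bracket (q $ 2) * f (vector [q $ 1 * bracket (q $ 2), q $ 2]))"
    "\<And>q. \<bar>q $ 1\<bar> > R \<Longrightarrow> V q = 0"
    "\<And>q. V (clamp_snd R q) = V q"
proof
  define g where "g s t = bracket t * f (vector [s * bracket t, t])" for s t
  have g_Ck: "Ck k (\<lambda>x. g (a x) (b x))" if "Ck k a" "Ck k b"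
    for k and a b :: "'b::euclidean_space \<Rightarrow> real"
    unfolding g_def
    by (intro Ck_mult Ck_bracket Ck_compose[OF f] Ck_vector_2 that)
  have g_0: "g s t = 0" if "\<bar>s\<bar> > R \<or> \<bar>t\<bar> \<ge> R" for s t
  proof -
    have "R \<le> norm (vector [s * bracket t, t] :: real^2)"
      using that le_norm_vector_bracket[where s=s and t=t] by auto
    then show ?thesis using supp by (simp add: g_def)
  qed
  \<comment> \<open>\<open>\<integral>\<^bsub>-R\<^esub>\<^bsup>y\<^esup> g s t dt\<close> rescaled to a fixed interval: it is then smooth in \<open>y\<close> by
    \<open>Ck_integral\<close>, and oriented correctly for \<open>y < -R\<close>\<close>
  define I where "I s y = (y - (-R)) * integral (cbox 0 1) (\<lambda>\<tau>. g s (-R + \<tau> * (y - (-R))))" for s y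
  define V where "V q = bracket (q $ 1) ^ 3 * I (q $ 1) (q $ 2)" for q :: "real^2"
  have I_deriv: "(I s has_real_derivative g s y) (at y)" for s y
    unfolding I_def
    by (intro has_real_derivative_scaled_integral Ck_imp_continuous_on[where k=0]
          g_Ck[OF Ck_const Ck_bounded_linear[OF bounded_linear_ident]])
  have fst: "Ck k (\<lambda>p::(real^2) \<times> real. fst p $ i)" for k i
    by (intro Ck_bounded_linear bounded_linear_compose[OF bounded_linear_vec_nth] bounded_linear_fst)
  \<comment> \<open>The integrand is written through \<open>fst\<close> and \<open>snd\<close> of
    the pair \<open>(q, \<tau>)\<close> to match the joint function \<open>H\<close> of
    \<open>Ck_integral\<close>.\<close>
  have "Ck k (\<lambda>q::real^2. integral (cbox 0 1)
          (\<lambda>\<tau>. g (fst (q, \<tau>) $ 1) (-R + snd (q, \<tau>) * (fst (q, \<tau>) $ 2 + R))))" for k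
    by (rule Ck_integral, rule g_Ck)
       (intro Ck_add Ck_mult Ck_const fst Ck_bounded_linear[OF bounded_linear_snd])+
  then show V_Ck: "Ck k V" for k
    unfolding V_def I_def by (auto intro!: Ck_intros simp del: minus_mult_minus)
  show "frechet_derivative V (at q) (axis 2 1) =
        bracket (q $ 1) ^ 3 * (bracket (q $ 2) * f (vector [q $ 1 * bracket (q $ 2), q $ 2]))" for q
  proof (rule DERIV_unique)
    show "((\<lambda>y. V (vector [q $ 1, y])) has_real_derivative frechet_derivative V (at q) (axis 2 1)) (at (q $ 2))"
      using partial_derivatives_vector_2(2)[OF V_Ck, of "q $ 1" "q $ 2"] by simp
    show "((\<lambda>y. V (vector [q $ 1, y])) has_real_derivative
        bracket (q $ 1) ^ 3 * (bracket (q $ 2) * f (vector [q $ 1 * bracket (q $ 2), q $ 2]))) (at (q $ 2))"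
      unfolding V_def vector_2 using DERIV_cmult[OF I_deriv] by (simp add: g_def)
  qed
  show "V q = 0" if "\<bar>q $ 1\<bar> > R" for q
    using that by (simp add: V_def I_def g_0)
  have "I s (max (-R) (min R y)) = I s y" for s y
  proof -
    consider "y \<le> -R" | "-R < y" "y \<le> R" | "y > R" by linarith
    then show ?thesis
    proof cases
      case 1
      \<comment> \<open>All sample points lie between \<open>y\<close> and \<open>-R\<close>, hence
        outside the support. At \<open>y = -R\<close> itself the prefactor of \<open>I\<close>
        vanishes, so both values are 0.\<close>
      have "g s (-R + \<tau> * (y - (-R))) = 0" if "\<tau> \<in> cbox 0 1" for \<tau>
      proof (rule g_0)
        have "\<tau> * (y - (-R)) \<le> 0"
          using 1 that by (intro mult_nonneg_nonpos) auto
        then show "R < \<bar>s\<bar> \<or> R \<le> \<bar>-R + \<tau> * (y - (-R))\<bar>" using \<open>R > 0\<close> by simp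
      qed
      then have "integral (cbox 0 1) (\<lambda>\<tau>. g s (-R + \<tau> * (y - (-R)))) = 0"
        by (intro integral_unique has_integral_is_0)
      then have "I s y = 0" by (simp only: I_def mult_zero_right)
      moreover have "max (-R) (min R y) = -R" using 1 \<open>R > 0\<close> by simp
      ultimately show ?thesis by (simp add: I_def)
    next
      case 3
      \<comment> \<open>Above the support the integral has stopped growing; it keeps the total over
        the whole curve, which need not be 0.\<close>
      have "I s y = I s R"
      proof (rule DERIV_isconst_end[OF 3])
        show "continuous_on {R..y} (I s)"
          using I_deriv by (intro DERIV_continuous_on) (rule has_field_derivative_at_within)
        show "(I s has_real_derivative 0) (at x)" if "R < x" "x < y" for x
          using I_deriv[of s x] g_0[of s x] that \<open>R > 0\<close> by simp
      qed
      moreover have "max (-R) (min R y) = R" using 3 \<open>R > 0\<close> by simp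
      ultimately show ?thesis by simp
    qed auto
  qed
  then show "V (clamp_snd R q) = V q" for q
    by (simp add: V_def clamp_snd_def)
qed

subsection \<open>The map\<close>

lemma norm_matrix_le:
  fixes A :: "real^'n^'m"
  assumes "\<And>i j. \<bar>A $ i $ j\<bar> \<le> c"
  shows "norm A \<le> real CARD('m) * (real CARD('n) * c)"
proof -
  have "norm (A $ i) \<le> real CARD('n) * c" for i
  proof -
    have "norm (A $ i) \<le> (\<Sum>j\<in>UNIV. \<bar>A $ i $ j\<bar>)"
      by (rule norm_le_l1_cart)
    also have "\<dots> \<le> real CARD('n) * c"
      using assms by (intro sum_bounded_above) auto
    finally show ?thesis .
  qed
  then have "(\<Sum>i\<in>UNIV. norm (A $ i)) \<le> real CARD('m) * (real CARD('n) * c)"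
    by (intro sum_bounded_above) auto
  moreover have "norm A \<le> (\<Sum>i\<in>UNIV. norm (A $ i))"
    unfolding norm_vec_def by (rule L2_set_le_sum) simp
  ultimately show ?thesis by linarith
qed

theorem corollary1p3:
  fixes f :: "real ^ 2 \<Rightarrow> real" and p :: real
  assumes "f \<in> Cc_infinity" and "p > 1"
  shows "\<exists>u :: real ^ 2 \<Rightarrow> real ^ 2.
           u \<in> homogeneous_Sobolev (2 * p) \<inter> L_infinity \<and>
           (\<forall>z. det (jacobian u (at z)) = f z) \<and>
           smooth u"
proof -

  \<comment> \<open>Support of \<open>f\<close> and weighted bounds on the potential\<close>
  have f: "Ck k f" for k
    using assms(1) by (simp add: Cc_infinity_def smooth_def)
  have "bounded {z. f z \<noteq> 0}"
    using assms(1) bounded_subset[OF compact_imp_bounded closure_subset]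
    by (auto simp: Cc_infinity_def)
  then obtain R0 where R0: "\<And>z. f z \<noteq> 0 \<Longrightarrow> norm z \<le> R0"
    by (auto simp: bounded_iff)
  \<comment> \<open>Adding 1 makes \<open>R\<close> positive and forces \<open>f\<close> to vanish
    already on the sphere of radius \<open>R\<close>.\<close>
  define R where "R = \<bar>R0\<bar> + 1"
  have "R > 0" and supp: "\<And>z. norm z \<ge> R \<Longrightarrow> f z = 0"
    using R0 by (force simp: R_def)+
  obtain V :: "real^2 \<Rightarrow> real" where V: "\<And>k. Ck k V"
    and V_y: "\<And>q. frechet_derivative V (at q) (axis 2 1) =
        bracket (q $ 1) ^ 3 * (bracket (q $ 2) * f (vector [q $ 1 * bracket (q $ 2), q $ 2]))"
    and V_supp: "\<And>q. \<bar>q $ 1\<bar> > R \<Longrightarrow> V q = 0"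
    and V_clamp: "\<And>q. V (clamp_snd R q) = V q"
    by (rule exists_fan_potential[OF f \<open>R > 0\<close> supp]) blast+
  let ?Vs = "\<lambda>q. frechet_derivative V (at q) (axis 1 1)"
  let ?Vy = "\<lambda>q. frechet_derivative V (at q) (axis 2 1)"
  obtain C0 where C0: "\<And>q. \<bar>V q\<bar> \<le> C0"
    using bounded_of_clamp_snd[OF Ck_imp_continuous_on[OF V] \<open>R > 0\<close> V_supp V_clamp] by blast
  \<comment> \<open>The weight is chosen for the final estimate: multiplied by \<open>\<rho>\<close>
    it becomes \<open>bracket s / bracket y\<close>, the bound for the differential of
    \<open>s\<close>. It costs nothing because the support is bounded in \<open>s\<close>.\<close>
  obtain C1 where C1: "C1 \<ge> 0" "\<And>q. \<bar>?Vs q * (bracket (q $ 1))\<^sup>2\<bar> \<le> C1"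
  proof (rule bounded_of_clamp_snd[OF _ \<open>R > 0\<close>])
    show "continuous_on UNIV (\<lambda>q. ?Vs q * (bracket (q $ 1))\<^sup>2)"
      using V[of "Suc 0"] by (intro continuous_on_mult Ck_imp_continuous_on[of 0] Ck_intros) auto
    show "?Vs q * (bracket (q $ 1))\<^sup>2 = 0" if "\<bar>q $ 1\<bar> > R" for q
    proof -
      have "closed {q::real^2. \<bar>q $ 1\<bar> \<le> R}"
        by (intro closed_Collect_le continuous_intros)
      then have "?Vs q = 0"
        by (rule frechet_derivative_eq_0_outside) (use that in \<open>simp_all add: V_supp\<close>)
      then show ?thesis by simp
    qed
    show "?Vs (clamp_snd R q) * (bracket (clamp_snd R q $ 1))\<^sup>2 = ?Vs q * (bracket (q $ 1))\<^sup>2" for q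
    proof -
      let ?y = "max (-R) (min R (q $ 2))"
      \<comment> \<open>Clamping changes only the height, and \<open>V\<close> restricted to the two
        horizontal lines is the same function of \<open>s\<close>, so the
        \<open>s\<close>-derivatives agree.\<close>
      have "(\<lambda>s. V (vector [s, ?y])) = (\<lambda>s. V (vector [s, q $ 2]))"
        using V_clamp[of "vector [s, q $ 2]" for s] by (simp add: fun_eq_iff clamp_snd_def)
      then have "?Vs (vector [q $ 1, ?y]) = ?Vs (vector [q $ 1, q $ 2])"
        using partial_derivatives_vector_2(1)[OF V, of ?y "q $ 1"]
          partial_derivatives_vector_2(1)[OF V, of "q $ 2" "q $ 1"] DERIV_unique by metis
      then show ?thesis by (simp add: clamp_snd_def)
    qed
  qed blast
  \<comment> \<open>Here the weight is the reciprocal of \<open>\<rho>\<close>, harmless since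
    \<open>?Vy\<close> is supported where both coordinates are bounded.\<close>
  obtain C2 where C2: "C2 \<ge> 0" "\<And>q. \<bar>?Vy q * (bracket (q $ 1) * bracket (q $ 2))\<bar> \<le> C2"
  proof (rule bounded_of_clamp_snd[OF _ \<open>R > 0\<close>])
    show "continuous_on UNIV (\<lambda>q. ?Vy q * (bracket (q $ 1) * bracket (q $ 2)))"
      using V[of "Suc 0"] by (intro continuous_on_mult Ck_imp_continuous_on[of 0] Ck_intros) auto
    \<comment> \<open>The non-strict inequality matters: clamping sends distant points to height
      exactly \<open>R\<close> or \<open>-R\<close>.\<close>
    have Vy_0: "?Vy q = 0" if "\<bar>q $ 1\<bar> > R \<or> \<bar>q $ 2\<bar> \<ge> R" for q
    proof -
      have "R \<le> norm (vector [q $ 1 * bracket (q $ 2), q $ 2] :: real^2)"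
        using that le_norm_vector_bracket[where s="q $ 1" and t="q $ 2"] by auto
      then show ?thesis by (simp add: V_y supp)
    qed
    then show "?Vy q * (bracket (q $ 1) * bracket (q $ 2)) = 0" if "\<bar>q $ 1\<bar> > R" for q
      using that by simp
    show "?Vy (clamp_snd R q) * (bracket (clamp_snd R q $ 1) * bracket (clamp_snd R q $ 2))
        = ?Vy q * (bracket (q $ 1) * bracket (q $ 2))" for q
    proof (cases "\<bar>q $ 2\<bar> \<ge> R")
      case True
      then have "\<bar>clamp_snd R q $ 2\<bar> \<ge> R"
        using \<open>R > 0\<close> by (auto simp: clamp_snd_def)
      with True show ?thesis by (simp add: Vy_0)
    next
      case False
      then have "clamp_snd R q = q"
        by (simp add: clamp_snd_def vec_eq_iff forall_2)
      then show ?thesis by simp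
    qed
  qed blast

  \<comment> \<open>The map, its derivative and its determinant\<close>
  define s where "s z = z $ 1 / bracket (z $ 2)" for z :: "real^2"
  define q where "q z = (vector [s z, z $ 2] :: real^2)" for z
  define u where "u z = (vector [s z / bracket (s z), V (q z)] :: real^2)" for z
  have s_Ck: "Ck k s" for k
    unfolding s_def[abs_def] by (intro Ck_intros) simp
  have u_Ck: "Ck k u" for k
    unfolding u_def[abs_def] q_def by (intro Ck_intros s_Ck Ck_compose[OF V]) simp

  \<comment> \<open>The differential of \<open>s\<close>, with partial derivatives
    \<open>1/w\<close> and \<open>-x y/w^3\<close> for \<open>w = bracket y\<close>.\<close>
  define ds where "ds z v = v $ 1 / bracket (z $ 2)
      - z $ 1 * z $ 2 / bracket (z $ 2) ^ 3 * v $ 2" for z v :: "real^2"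
  have bracket_deriv: "((\<lambda>x. bracket (h x)) has_derivative (\<lambda>v. h x / bracket (h x) * h' v)) (at x)"
    if "(h has_derivative h') (at x)" for h h' and x :: "real^2"
    using has_derivative_compose[OF that has_real_derivative_bracket[unfolded has_field_derivative_def]] .
  have s_deriv: "(s has_derivative ds z) (at z)" for z
  proof -
    have "((\<lambda>z. z $ 1 / bracket (z $ 2)) has_derivative
        (\<lambda>v. - z $ 1 * (inverse (bracket (z $ 2)) * (z $ 2 / bracket (z $ 2) * v $ 2)
            * inverse (bracket (z $ 2))) + v $ 1 / bracket (z $ 2))) (at z)"
      by (intro has_derivative_divide bracket_deriv bounded_linear_imp_has_derivative
            bounded_linear_vec_nth bracket_neq_0)
    moreover have "(\<lambda>v. - z $ 1 * (inverse (bracket (z $ 2)) * (z $ 2 / bracket (z $ 2) * v $ 2)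
            * inverse (bracket (z $ 2))) + v $ 1 / bracket (z $ 2)) = ds z"
      by (simp add: fun_eq_iff ds_def field_simps power3_eq_cube)
    ultimately show ?thesis by (simp add: s_def[abs_def])
  qed
  have unit_deriv: "((\<lambda>z. s z / bracket (s z)) has_derivative (\<lambda>v. ds z v / bracket (s z) ^ 3)) (at z)" for z
  proof -
    let ?b = "bracket (s z)"
    have "((\<lambda>z. s z / bracket (s z)) has_derivative
        (\<lambda>v. - s z * (inverse ?b * (s z / ?b * ds z v) * inverse ?b) + ds z v / ?b)) (at z)"
      by (intro has_derivative_divide bracket_deriv s_deriv bracket_neq_0)
    moreover have "- s z * (inverse ?b * (s z / ?b * ds z v) * inverse ?b) + ds z v / ?b
        = ds z v / ?b ^ 3" for v
    proof -
      \<comment> \<open>The numerator \<open>?b\<^sup>2 - (s z)\<^sup>2\<close> is 1 by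
        \<open>bracket_sq\<close>, which leaves the pure inverse cube.\<close>
      have "- s z * (inverse ?b * (s z / ?b * ds z v) * inverse ?b) + ds z v / ?b
          = ds z v * (?b\<^sup>2 - (s z)\<^sup>2) / ?b ^ 3"
        by (simp add: field_simps power2_eq_square power3_eq_cube)
      then show ?thesis by (simp add: bracket_sq)
    qed
    ultimately show ?thesis by simp
  qed
  have "((\<lambda>z. V (q z)) has_derivative (\<lambda>v. ds z v * ?Vs (q z) + v $ 2 * ?Vy (q z))) (at z)" for z
  proof -
    have "(q has_derivative (\<lambda>v. vector [ds z v, v $ 2])) (at z)"
      unfolding q_def[abs_def]
      by (intro has_derivative_vector_2 s_deriv bounded_linear_imp_has_derivative bounded_linear_vec_nth)
    from has_derivative_compose[OF this Ck_Suc_has_derivative[OF V]] show ?thesis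
      unfolding linear_vector_2[OF has_derivative_linear[OF Ck_Suc_has_derivative[OF V]]] .
  qed
  from has_derivative_vector_2[OF unit_deriv this]
  have u_deriv: "(u has_derivative
      (\<lambda>v. vector [ds z v / bracket (s z) ^ 3, ds z v * ?Vs (q z) + v $ 2 * ?Vy (q z)])) (at z)" for z
    by (simp add: u_def[abs_def])
  have J: "jacobian u (at z) $ 1 $ j = ds z (axis j 1) / bracket (s z) ^ 3"
      "jacobian u (at z) $ 2 $ j = ds z (axis j 1) * ?Vs (q z) + axis j 1 $ 2 * ?Vy (q z)" for z j
    by (simp_all add: jacobian_def matrix_def frechet_derivative_at[OF u_deriv, symmetric])

  have det: "det (jacobian u (at z)) = f z" for z
  proof -
    \<comment> \<open>The \<open>?Vs\<close> part of the second row is a multiple of the first row,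
      so it drops out of the determinant.\<close>
    have "det (jacobian u (at z)) = ds z (axis 1 1) / bracket (s z) ^ 3 * ?Vy (q z)"
      unfolding det_2 J by (simp add: axis_def algebra_simps)
    also have "\<dots> = f (vector [s z * bracket (z $ 2), z $ 2])"
      unfolding V_y by (simp add: ds_def q_def axis_def)
    also have "vector [s z * bracket (z $ 2), z $ 2] = z"
      by (simp add: s_def)
    finally show ?thesis .
  qed

  \<comment> \<open>Pointwise decay of the Jacobian matrix\<close>
  define \<rho> where "\<rho> z = 1 / sqrt (1 + (norm z)\<^sup>2)" for z :: "real^2"
  have \<rho>: "\<rho> z = 1 / (bracket (s z) * bracket (z $ 2))" for z
    by (simp add: \<rho>_def s_def bracket_mult norm_sq_vec_2 add.assoc)
  \<comment> \<open>The 1 serves the first row of the matrix, \<open>C1 + C2\<close> the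
    second.\<close>
  define C where "C = 1 + C1 + C2"
  have J_le: "\<bar>jacobian u (at z) $ i $ j\<bar> \<le> C * \<rho> z" for z i j
  proof -
    let ?b = "bracket (s z)" and ?w = "bracket (z $ 2)"
    have \<rho>_pos: "\<rho> z \<ge> 0" by (simp add: \<rho>_def)
    \<comment> \<open>A common bound for both partial derivatives of \<open>s\<close>: the first is
      \<open>1 / ?w\<close>, and the second gains a factor \<open>s z\<close>, absorbed by
      \<open>?b\<close>, and a factor \<open>z $ 2 / ?w\<close> of modulus at most 1.\<close>
    have ds_le: "\<bar>ds z (axis j 1)\<bar> \<le> ?b / ?w" for j
    proof -
      have "j = 1 \<or> j = 2" using exhaust_2 by blast
      then show ?thesis
      proof
        assume "j = 1"
        then have "\<bar>ds z (axis j 1)\<bar> = 1 / ?w"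
          by (simp add: ds_def axis_def abs_of_pos)
        also have "\<dots> \<le> ?b / ?w"
          by (intro divide_right_mono bracket_ge_1) (simp add: less_imp_le)
        finally show ?thesis .
      next
        assume "j = 2"
        then have "ds z (axis j 1) = - (s z * (z $ 2 / ?w) / ?w)"
          by (simp add: ds_def axis_def s_def power3_eq_cube)
        then have "\<bar>ds z (axis j 1)\<bar> = \<bar>s z\<bar> * (\<bar>z $ 2\<bar> / ?w) / ?w"
          by (simp add: abs_mult abs_of_pos)
        also have "\<dots> \<le> ?b * 1 / ?w"
          by (intro divide_right_mono mult_mono abs_le_bracket)
             (simp_all add: abs_le_bracket less_imp_le)
        finally show ?thesis by simp
      qed
    qed
    have "i = 1 \<or> i = 2" using exhaust_2 by blast
    then show ?thesis
    proof
      assume "i = 1"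
      then have "\<bar>jacobian u (at z) $ i $ j\<bar> = \<bar>ds z (axis j 1)\<bar> / ?b ^ 3"
        by (simp add: J abs_of_pos)
      also have "\<dots> \<le> (?b / ?w) / ?b ^ 3"
        by (intro divide_right_mono ds_le) (simp add: less_imp_le)
      also have "\<dots> = \<rho> z / ?b"
        by (simp add: \<rho> field_simps power3_eq_cube)
      also have "\<dots> \<le> \<rho> z"
        using \<rho>_pos bracket_ge_1[of "s z"] by (simp add: divide_le_eq mult_le_cancel_left1)
      also have "\<dots> \<le> C * \<rho> z"
        using mult_right_mono[OF _ \<rho>_pos, of 1 C] C1(1) C2(1) by (simp add: C_def)
      finally show ?thesis .
    next
      assume "i = 2"
      then have "\<bar>jacobian u (at z) $ i $ j\<bar> \<le> \<bar>ds z (axis j 1) * ?Vs (q z)\<bar> + \<bar>axis j 1 $ 2 * ?Vy (q z)\<bar>"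
        by (simp add: J abs_triangle_ineq)
      also have "\<dots> \<le> (?b / ?w) * \<bar>?Vs (q z)\<bar> + 1 * \<bar>?Vy (q z)\<bar>"
        unfolding abs_mult
        by (intro add_mono mult_right_mono ds_le) (auto simp: axis_def)
      also have "\<dots> = \<rho> z * (\<bar>?Vs (q z) * ?b\<^sup>2\<bar> + \<bar>?Vy (q z) * (?b * ?w)\<bar>)"
        by (simp add: \<rho> abs_mult abs_of_pos field_simps power2_eq_square)
      also have "\<dots> \<le> \<rho> z * (C1 + C2)"
        using C1(2)[of "q z"] C2(2)[of "q z"]
        by (intro mult_left_mono[OF _ \<rho>_pos] add_mono) (simp_all add: q_def)
      also have "\<dots> \<le> C * \<rho> z"
        using \<rho>_pos by (simp add: C_def algebra_simps)
      finally show ?thesis .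
    qed
  qed

  \<comment> \<open>Membership in the Sobolev space and boundedness\<close>
  have "integrable lebesgue (\<lambda>z. norm (jacobian u (at z)) powr (2 * p))"
  proof (rule Bochner_Integration.integrable_bound)
    \<comment> \<open>In the plane the decay criterion \<open>2 * a > DIM('a)\<close> with
      \<open>a = p\<close> reads \<open>p > 1\<close>.\<close>
    have "integrable lborel (\<lambda>z::real^2. (1 + (norm z)\<^sup>2) powr (-p))"
      using assms(2) by (intro integrable_lborel_powr_decay) simp
    then show "integrable lebesgue (\<lambda>z::real^2. (4 * C) powr (2 * p) * (1 + (norm z)\<^sup>2) powr (-p))"
      by (intro integrable_mult_right)
         (simp add: integrable_completion borel_measurable_integrable)
    have "continuous_on UNIV (\<lambda>z. norm (jacobian u (at z)) powr (2 * p))"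
      using assms(2) Ck1_has_weak_gradient(1)[OF u_Ck]
      by (intro continuous_on_powr' continuous_on_norm continuous_on_const) auto
    then show "(\<lambda>z. norm (jacobian u (at z)) powr (2 * p)) \<in> borel_measurable lebesgue"
      by (rule continuous_imp_borel_measurable_lebesgue)
    show "AE z in lebesgue. norm (norm (jacobian u (at z)) powr (2 * p))
        \<le> norm ((4 * C) powr (2 * p) * (1 + (norm z)\<^sup>2) powr (-p))"
    proof (rule AE_I2)
      fix z :: "real^2"
      have C: "C > 0" using C1(1) C2(1) by (simp add: C_def)
      have "1 + (norm z)\<^sup>2 > 0" by (simp add: add_pos_nonneg)
      then have \<rho>_powr: "\<rho> z = (1 + (norm z)\<^sup>2) powr (- (1/2))"
        by (simp add: \<rho>_def powr_minus_divide powr_half_sqrt)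
      \<comment> \<open>The factor 4 counts the entries of the matrix.\<close>
      have "norm (jacobian u (at z)) \<le> 4 * C * \<rho> z"
        using norm_matrix_le[of "jacobian u (at z)" "C * \<rho> z"] J_le by simp
      then have "norm (jacobian u (at z)) powr (2 * p) \<le> (4 * C * \<rho> z) powr (2 * p)"
        using assms(2) by (intro powr_mono2) auto
      also have "\<dots> = (4 * C) powr (2 * p) * \<rho> z powr (2 * p)"
        by (rule powr_mult)
      also have "\<rho> z powr (2 * p) = (1 + (norm z)\<^sup>2) powr (-p)"
        unfolding \<rho>_powr powr_powr by simp
      finally show "norm (norm (jacobian u (at z)) powr (2 * p))
          \<le> norm ((4 * C) powr (2 * p) * (1 + (norm z)\<^sup>2) powr (-p))"
        by simp
    qed
  qed
  then have "(\<lambda>z. jacobian u (at z)) \<in> Lp_space (2 * p)"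
    using continuous_imp_borel_measurable_lebesgue[OF Ck1_has_weak_gradient(1)[OF u_Ck]]
    by (simp add: Lp_space_def)
  then have "u \<in> homogeneous_Sobolev (2 * p)"
    unfolding homogeneous_Sobolev_def using Ck1_has_weak_gradient(2)[OF u_Ck] by blast
  moreover have "u \<in> L_infinity"
  proof -
    have "norm (u z) \<le> 1 + C0" for z
    proof -
      have "\<bar>u z $ 1\<bar> \<le> 1"
        by (simp add: u_def abs_of_pos abs_le_bracket)
      moreover have "\<bar>u z $ 2\<bar> \<le> C0"
        by (simp add: u_def C0)
      moreover have "norm (u z) \<le> \<bar>u z $ 1\<bar> + \<bar>u z $ 2\<bar>"
        using norm_le_l1_cart[of "u z"] by (simp add: sum_2)
      ultimately show ?thesis by linarith
    qed
    then show ?thesis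
      using continuous_imp_borel_measurable_lebesgue[OF Ck_imp_continuous_on[OF u_Ck]]
      by (auto simp: L_infinity_def)
  qed
  ultimately show ?thesis
    using det u_Ck by (auto simp: smooth_def)
qed

end
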